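(* Let $\chi:\mathbb{R}^2\to\mathbb{R}$ be a kernel as in the context and let $f\in C^{2}(\mathbb{R}^{2})$. Then for every $w>0$ and every $(x,y)\in\mathbb{R}^2$, $$(S_{w} f)(x,y)= (G_{w} f)(x,y)+ \frac{1}{2w} (G_{w}f_{x})(x,y) + \frac{1}{2w} (G_{w}f_{y})(x,y) +\hat R_{2}^{w}(x,y),$$ where the remainder $\hat R_2^w(x,y)$ of order $2$ is the series, absolutely convergent for every $(x,y)\in\mathbb{R}^2$, $$\hat R_{2}^{w}(x,y)= \frac{1}{2!} \sum_{k \in \mathbb{Z}} \sum_{j \in \mathbb{Z}} \chi(wx-k, wy-j)\Bigg[ w^{2} \int_{\frac{k}{w}}^{\frac{k+1}{w}} \int_{\frac{j}{w}}^{\frac{j+1}{w}} \Big\{ f_{xx}\big( \theta_{k,w}(u),\theta_{j,w}(v) \big)\Big( u - \frac{k}{w}\Big)^{2} + 2 f_{xy}\big( \theta_{k,w}(u),\theta_{j,w}(v) \big)\Big(u - \frac{k}{w}\Big)\Big( v - \frac{j}{w}\Big) + f_{yy}\big( \theta_{k,w}(u),\theta_{j,w}(v) \big)\Big( v - \frac{j}{w}\Big)^{2} \Big\}\, dv\, du \Bigg],$$ for suitable measurable functions $\theta_{k,w}(u)$ and $\theta_{j,w}(v)$ with $\frac{k}{w} < \theta_{k,w}(u) < \frac{k+1}{w}$ and $\frac{j}{w} < \theta_{j,w}(v) < \frac{j+1}{w}$ for all $k,j\in\mathbb{Z}$, $u \in \big( \frac{k}{w},\frac{k+1}{w} \big)$,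 $v \in \big(\frac{j}{w},\frac{j+1}{w} \big)$, $w>0$. (Here $\theta_{k,w}(u)$ and $\theta_{j,w}(v)$ abbreviate the two coordinates of the intermediate point in the second-order Taylor formula of $f$ around $(\frac kw,\frac jw)$ evaluated at $(u,v)$; both coordinates are allowed to depend on $f,w,k,j,u,v$ and are measurable in $(u,v)$.)
   Context: $C^r(\mathbb{R}^2)$ is the space of continuous functions $f:\mathbb{R}^2\to\mathbb{R}$ all of whose partial derivatives up to order $r$ (including $f$ itself) are continuous and bounded on $\mathbb{R}^2$. Subscripts $x,y$ denote partial derivatives in the first and second variable. For $p=(p_1,p_2)\in\mathbb{N}_0^2$ with $p_1+p_2=\eta$, the absolute moments of $\chi$ are $$M^{\eta}_{(p_1,p_2)}(\chi)=\sup_{(u,v)\in\mathbb{R}^2}\sum_{k\in\mathbb{Z}}\sum_{j\in\mathbb{Z}}|\chi(u-k,v-j)|\,|u-k|^{p_1}|v-j|^{p_2},\qquad M_\eta(\chi)=\max_{p_1+p_2=\eta}M^{\eta}_{(p_1,p_2)}(\chi).$$ Standing assumptions on the kernel: $\chi\in C^0(\mathbb{R}^2)$ (continuous and bounded); (K1) $\chi$ is integrable and bounded at the origin; (K2) $\sum_{k\in\mathbb{Z}}\sum_{j\in\mathbb{Z}}\chi(u-k,v-j)=1$ for every $(u,v)\in\mathbb{R}^2$; (K3) $M_\eta(\chi)<+\infty$ for some $\eta=p_1+p_2$ with $p_1,p_2$ positive integers. For $w>0$ the bivariate generalized sampling series and its Kantorovich version are $$(G_w f)(x,y)=\sum_{k\in\mathbb{Z}}\sum_{j\in\mathbb{Z}}\chi(wx-k,wy-j)\,f\Big(\frac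 kw,\frac jw\Big),$$ $$(S_w f)(x,y)=\sum_{k\in\mathbb{Z}}\sum_{j\in\mathbb{Z}}\chi(wx-k,wy-j)\Bigg[w^2\int_{\frac kw}^{\frac{k+1}w}\int_{\frac jw}^{\frac{j+1}w}f(u,v)\,dv\,du\Bigg],$$ where $u$ ranges over $(\frac kw,\frac{k+1}w)$ and $v$ over $(\frac jw,\frac{j+1}w)$. *)

theory Defs
  imports "HOL-Analysis.Analysis"
begin

definition partial_x :: "(real \<times> real \<Rightarrow> real) \<Rightarrow> real \<times> real \<Rightarrow> real" where
  "partial_x f = (\<lambda>(x, y). deriv (\<lambda>t. f (t, y)) x)"

definition partial_y :: "(real \<times> real \<Rightarrow> real) \<Rightarrow> real \<times> real \<Rightarrow> real" where
  "partial_y f = (\<lambda>(x, y). deriv (\<lambda>t. f (x, t)) y)"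

(* Every partial derivative of order at most r, mixed ones taken in any order of
   differentiation, exists everywhere and is continuous and bounded.  Existence is demanded
   separately because deriv is total. *)
fun C_bounded :: "nat \<Rightarrow> (real \<times> real \<Rightarrow> real) set" where
  "C_bounded 0 = {f. continuous_on UNIV f \<and> bounded (range f)}"
| "C_bounded (Suc r) = {f. continuous_on UNIV f \<and> bounded (range f) \<and>
      (\<forall>x y. (\<lambda>t. f (t, y)) field_differentiable (at x) \<and>
             (\<lambda>t. f (x, t)) field_differentiable (at y)) \<and>
      partial_x f \<in> C_bounded r \<and> partial_y f \<in> C_bounded r}"

(* Taken in ennreal, so that a divergent sum or supremum has the value \<infinity>. *)
definition abs_moment :: "(real \<times> real \<Rightarrow> real) \<Rightarrow> nat \<Rightarrow> nat \<Rightarrow> ennreal" where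
  "abs_moment \<kappa> p1 p2 = (SUP (u, v). \<Sum>\<^sub>\<infinity>k. \<Sum>\<^sub>\<infinity>j.
     ennreal (\<bar>\<kappa> (u - of_int k, v - of_int j)\<bar> * \<bar>u - of_int k\<bar> ^ p1 * \<bar>v - of_int j\<bar> ^ p2))"

definition max_abs_moment :: "(real \<times> real \<Rightarrow> real) \<Rightarrow> nat \<Rightarrow> ennreal" where
  "max_abs_moment \<kappa> \<eta> = Max {abs_moment \<kappa> p1 p2 | p1 p2. p1 + p2 = \<eta>}"

definition double_series :: "(int \<Rightarrow> int \<Rightarrow> real) \<Rightarrow> real" where
  "double_series a = (\<Sum>\<^sub>\<infinity>k. \<Sum>\<^sub>\<infinity>j. a k j)"

definition abs_convergent :: "(int \<Rightarrow> int \<Rightarrow> real) \<Rightarrow> bool" where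
  "abs_convergent a \<longleftrightarrow> (\<lambda>(k, j). \<bar>a k j\<bar>) summable_on UNIV"

(* In the partition-of-unity conjunct the moment condition makes the double series absolutely
   convergent, so the default value 0 of infsum plays no role. *)
definition sampling_kernel :: "(real \<times> real \<Rightarrow> real) \<Rightarrow> bool" where
  "sampling_kernel \<kappa> \<longleftrightarrow>
     \<kappa> \<in> C_bounded 0 \<and>
     integrable lborel \<kappa> \<and> (\<exists>e>0. bounded (\<kappa> ` ball 0 e)) \<and>
     (\<forall>u v. double_series (\<lambda>k j. \<kappa> (u - of_int k, v - of_int j)) = 1) \<and>
     (\<exists>p1 p2. 0 < p1 \<and> 0 < p2 \<and> max_abs_moment \<kappa> (p1 + p2) < \<infinity>)"

definition cell_mean :: "real \<Rightarrow> int \<Rightarrow> int \<Rightarrow> (real \<Rightarrow> real \<Rightarrow> real) \<Rightarrow> real" where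
  "cell_mean w k j h = w\<^sup>2 * (LBINT u:{of_int k / w<..<(of_int k + 1) / w}.
                             LBINT v:{of_int j / w<..<(of_int j + 1) / w}. h u v)"

definition G_term ::
  "(real \<times> real \<Rightarrow> real) \<Rightarrow> real \<Rightarrow> (real \<times> real \<Rightarrow> real) \<Rightarrow> real \<Rightarrow> real \<Rightarrow> int \<Rightarrow> int \<Rightarrow> real" where
  "G_term \<kappa> w f x y k j =
     \<kappa> (w * x - of_int k, w * y - of_int j) * f (of_int k / w, of_int j / w)"

definition S_term ::
  "(real \<times> real \<Rightarrow> real) \<Rightarrow> real \<Rightarrow> (real \<times> real \<Rightarrow> real) \<Rightarrow> real \<Rightarrow> real \<Rightarrow> int \<Rightarrow> int \<Rightarrow> real" where
  "S_term \<kappa> w f x y k j =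
     \<kappa> (w * x - of_int k, w * y - of_int j) * cell_mean w k j (\<lambda>u v. f (u, v))"

definition G_op ::
  "(real \<times> real \<Rightarrow> real) \<Rightarrow> real \<Rightarrow> (real \<times> real \<Rightarrow> real) \<Rightarrow> real \<Rightarrow> real \<Rightarrow> real" where
  "G_op \<kappa> w f x y = double_series (G_term \<kappa> w f x y)"

definition S_op ::
  "(real \<times> real \<Rightarrow> real) \<Rightarrow> real \<Rightarrow> (real \<times> real \<Rightarrow> real) \<Rightarrow> real \<Rightarrow> real \<Rightarrow> real" where
  "S_op \<kappa> w f x y = double_series (S_term \<kappa> w f x y)"

definition second_differential ::
  "(real \<times> real \<Rightarrow> real) \<Rightarrow> real \<times> real \<Rightarrow> real \<Rightarrow> real \<Rightarrow> real" where
  "second_differential f q h1 h2 =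
     partial_x (partial_x f) q * h1\<^sup>2 +
     2 * partial_y (partial_x f) q * h1 * h2 +
     partial_y (partial_y f) q * h2\<^sup>2"

(* q is an intermediate point in the second-order Taylor formula (Lagrange remainder) of f
   around (a, b), evaluated at (u, v). *)
definition taylor_point ::
  "(real \<times> real \<Rightarrow> real) \<Rightarrow> real \<Rightarrow> real \<Rightarrow> real \<Rightarrow> real \<Rightarrow> real \<times> real \<Rightarrow> bool" where
  "taylor_point f a b u v q \<longleftrightarrow>
     q \<in> open_segment (a, b) (u, v) \<and>
     f (u, v) = f (a, b) + partial_x f (a, b) * (u - a) + partial_y f (a, b) * (v - b) +
                1 / fact 2 * second_differential f q (u - a) (v - b)"

definition cell :: "real \<Rightarrow> int \<Rightarrow> int \<Rightarrow> (real \<times> real) set" where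
  "cell w k j = {of_int k / w<..<(of_int k + 1) / w} \<times> {of_int j / w<..<(of_int j + 1) / w}"

(* The coordinates \<theta>1 and \<theta>2 of the intermediate point may each depend on w, on both indices and
   on both variables. *)
definition R_term ::
  "(real \<times> real \<Rightarrow> real) \<Rightarrow> real \<Rightarrow> (real \<times> real \<Rightarrow> real) \<Rightarrow>
   (real \<Rightarrow> int \<Rightarrow> int \<Rightarrow> real \<times> real \<Rightarrow> real) \<Rightarrow> (real \<Rightarrow> int \<Rightarrow> int \<Rightarrow> real \<times> real \<Rightarrow> real) \<Rightarrow>
   real \<Rightarrow> real \<Rightarrow> int \<Rightarrow> int \<Rightarrow> real" where
  "R_term \<kappa> w f \<theta>1 \<theta>2 x y k j =
     \<kappa> (w * x - of_int k, w * y - of_int j) *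
     cell_mean w k j (\<lambda>u v. second_differential f (\<theta>1 w k j (u, v), \<theta>2 w k j (u, v))
                              (u - of_int k / w) (v - of_int j / w))"

end

theory Submission
  imports Defs
begin

text \<open>
  The identity is the second-order Taylor formula, averaged over each cell and then summed
  against the kernel. Around the corner \<open>(k/w, j/w)\<close> the formula with Lagrange remainder
  (\<open>Taylor_Lagrange\<close>) splits \<open>f\<close> on a cell into a constant, two linear terms and half the second
  differential at an intermediate point. The mean over the cell of an offset \<open>u - k/w\<close> or
  \<open>v - j/w\<close> is \<open>1/(2w)\<close>, which produces the coefficients of the two series of partial derivatives.

  Three points need care. First, the intermediate point must be a measurable function of
  \<open>(u, v)\<close>. The admissible parameters \<open>t \<in> (0, 1)\<close> on the segment are the zeros of a function
  \<open>F ((u, v), t)\<close> that is continuous in all variables, and a zero closest to \<open>1/2\<close> can be chosen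
  measurably, because the points with a zero within distance \<open>c\<close> of \<open>1/2\<close> form the projection of a
  closed set along a compact interval (\<open>measurable_least_zero\<close>, \<open>measurable_zero_in_interval\<close>).
  Second, the series must converge absolutely. As \<open>f\<close> and its first partial derivatives are
  bounded, this follows from absolute convergence of \<open>\<Sum> \<kappa> (u - k, v - j)\<close>, and the moments with
  exponents \<open>(\<eta>, 0)\<close> and \<open>(0, \<eta>)\<close> control that sum away from finitely many indices
  (\<open>sampling_kernel_abs_summable\<close>).
  Third, integrability of the remainder integrand: by the Taylor formula this integrand equals
  twice the difference of \<open>f\<close> and its first-order Taylor polynomial, a continuous function. So every term of the
  remainder series is a linear combination of terms of the other four series
  (\<open>cell_mean_Taylor_remainder\<close>), and both its absolute convergence and the identity follow from
  linearity of absolutely convergent double series.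
\<close>


section \<open>Functions with bounded continuous partial derivatives\<close>

lemma C_bounded_continuous: "f \<in> C_bounded r \<Longrightarrow> continuous_on A f"
  by (cases r) (auto intro: continuous_on_subset)

lemma C_bounded_bound:
  assumes "f \<in> C_bounded r"
  obtains B where "\<And>p. \<bar>f p\<bar> \<le> B"
proof -
  have "bounded (range f)" using assms by (cases r) auto
  then show thesis using that by (auto simp: bounded_iff)
qed

lemma C_bounded_partials:
  assumes "f \<in> C_bounded (Suc r)"
  shows "partial_x f \<in> C_bounded r" "partial_y f \<in> C_bounded r"
  using assms by auto

lemma C_bounded_DERIV:
  assumes "f \<in> C_bounded (Suc r)"
  shows "((\<lambda>t. f (t, y)) has_real_derivative partial_x f (x, y)) (at x)"
    and "((\<lambda>t. f (x, t)) has_real_derivative partial_y f (x, y)) (at y)"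
  using assms by (auto simp: partial_x_def partial_y_def field_differentiable_derivI)

text \<open>
  The definition of \<open>C_bounded\<close> speaks of derivatives along the axes only. Continuity of the
  partial derivatives gives total differentiability, which the chain rule along a slanted segment
  needs.
\<close>
lemma C_bounded_has_derivative:
  assumes f: "f \<in> C_bounded (Suc r)"
  shows "(f has_derivative (\<lambda>h. partial_x f p * fst h + partial_y f p * snd h)) (at p)"
proof -
  obtain x y where p: "p = (x, y)" by fastforce
  have cy: "continuous_on UNIV (partial_y f)"
    using C_bounded_continuous[OF C_bounded_partials(2)[OF f]] .
  have "((\<lambda>(x, y). curry f x y) has_derivative
      (\<lambda>(tx, ty). partial_x f (x, y) * tx + blinfun_mult_right (partial_y f (x, y)) ty))
      (at (x, y) within UNIV \<times> UNIV)"
  proof (rule has_derivative_partialsI)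
    show "((\<lambda>x. curry f x y) has_derivative (*) (partial_x f (x, y))) (at x within UNIV)"
      using C_bounded_DERIV(1)[OF f, of y x] by (simp add: has_field_derivative_def)
    show "((\<lambda>y. curry f x y) has_derivative blinfun_mult_right (partial_y f (x, y))) (at y within UNIV)"
      for x y
      using C_bounded_DERIV(2)[OF f, of x y]
      by (simp add: has_field_derivative_def blinfun_mult_right.rep_eq)
    have "continuous_on UNIV (\<lambda>p. blinfun_mult_right (partial_y f p))"
      by (intro bounded_linear.continuous_on[OF bounded_linear_blinfun_mult_right] cy)
    then show "continuous (at (x, y) within UNIV \<times> UNIV)
        (\<lambda>(x, y). blinfun_mult_right (partial_y f (x, y)))"
      by (simp add: continuous_on_eq_continuous_within case_prod_unfold)
  qed auto
  then show ?thesis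
    by (simp add: p case_prod_unfold blinfun_mult_right.rep_eq)
qed

section \<open>Symmetry of the second derivative\<close>

text \<open>
  Two applications of the mean value theorem, one in each variable, to the second difference over
  a square. This difference is symmetric in the two variables, whereas the derivative on the right
  is not; comparing \<open>f\<close> with its mirror image then yields Clairaut's theorem.
\<close>
lemma mixed_difference_quotient:
  assumes f: "f \<in> C_bounded 2" and h: "0 < h"
  obtains x y where "a < x" "x < a + h" "b < y" "y < b + h"
    "f (a + h, b + h) - f (a, b + h) - f (a + h, b) + f (a, b) = h\<^sup>2 * partial_y (partial_x f) (x, y)"
proof -
  have f': "f \<in> C_bounded (Suc (Suc 0))" using f by (simp only: numeral_2_eq_2)
  have "((\<lambda>t. f (t, b + h) - f (t, b)) has_real_derivative partial_x f (t, b + h) - partial_x f (t, b)) (at t)"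
    for t
    by (intro derivative_intros C_bounded_DERIV[OF f'])
  from MVT2[of a "a + h", OF _ this] h obtain x where x: "a < x" "x < a + h"
    "f (a + h, b + h) - f (a + h, b) - (f (a, b + h) - f (a, b)) =
      h * (partial_x f (x, b + h) - partial_x f (x, b))"
    by auto
  from MVT2[of b "b + h", OF _ C_bounded_DERIV(2)[OF C_bounded_partials(1)[OF f']], of x] h
  obtain y where "b < y" "y < b + h"
    "partial_x f (x, b + h) - partial_x f (x, b) = h * partial_y (partial_x f) (x, y)"
    by auto
  with x show thesis by (intro that[of x y]) (auto simp: power2_eq_square algebra_simps)
qed

lemma partials_swap:
  "partial_x (f \<circ> prod.swap) = partial_y f \<circ> prod.swap"
  "partial_y (f \<circ> prod.swap) = partial_x f \<circ> prod.swap"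
  by (auto simp: partial_x_def partial_y_def)

lemma C_bounded_swap: "f \<in> C_bounded r \<Longrightarrow> f \<circ> prod.swap \<in> C_bounded r"
proof (induction r arbitrary: f)
  case (0 f)
  have "continuous_on UNIV (\<lambda>p. f (prod.swap p))"
    using 0 by (auto intro: continuous_on_compose2[OF _ continuous_on_swap])
  moreover have "bounded (range (\<lambda>p. f (prod.swap p)))"
    by (rule bounded_subset[of "range f"]) (use 0 in auto)
  ultimately show ?case using 0 by (simp add: o_def)
next
  case (Suc r f)
  have "continuous_on UNIV (\<lambda>p. f (prod.swap p))"
    using Suc.prems by (auto intro: continuous_on_compose2[OF _ continuous_on_swap])
  moreover have "bounded (range (\<lambda>p. f (prod.swap p)))"
    by (rule bounded_subset[of "range f"]) (use Suc.prems in auto)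
  moreover have "partial_x f \<circ> prod.swap \<in> C_bounded r" "partial_y f \<circ> prod.swap \<in> C_bounded r"
    using C_bounded_partials[OF Suc.prems] by (blast intro: Suc.IH)+
  ultimately show ?case using Suc.prems
    by (auto simp only: C_bounded.simps mem_Collect_eq partials_swap) (auto simp: o_def)
qed

text \<open>
  In squares shrinking to \<open>(a, b)\<close> the second difference yields two points such that one mixed
  derivative at the first equals the other at the second, so by continuity both agree at \<open>(a, b)\<close>.
  The Taylor formula needs this because \<open>second_differential\<close> counts one of the two mixed derivatives twice.
\<close>
lemma mixed_partials_commute:
  assumes f: "f \<in> C_bounded 2"
  shows "partial_x (partial_y f) = partial_y (partial_x f)"
proof
  fix p :: "real \<times> real"
  obtain a b where p: "p = (a, b)" by fastforce
  have f': "f \<in> C_bounded (Suc (Suc 0))" using f by (simp only: numeral_2_eq_2)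
  define h where "h n = inverse (real (Suc n))" for n
  have h: "h n > 0" "h \<longlonglongrightarrow> 0" for n
    using LIMSEQ_inverse_real_of_nat by (auto simp: h_def [abs_def])
  have "\<exists>p q. p \<in> {a<..<a + h n} \<times> {b<..<b + h n} \<and> q \<in> {a<..<a + h n} \<times> {b<..<b + h n} \<and>
      partial_x (partial_y f) p = partial_y (partial_x f) q" for n
  proof -
    obtain x y where 1: "b < x" "x < b + h n" "a < y" "y < a + h n"
      "(f \<circ> prod.swap) (b + h n, a + h n) - (f \<circ> prod.swap) (b, a + h n)
         - (f \<circ> prod.swap) (b + h n, a) + (f \<circ> prod.swap) (b, a)
       = (h n)\<^sup>2 * partial_y (partial_x (f \<circ> prod.swap)) (x, y)"
      using mixed_difference_quotient[OF C_bounded_swap[OF f] h(1)] .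
    obtain x' y' where 2: "a < x'" "x' < a + h n" "b < y'" "y' < b + h n"
      "f (a + h n, b + h n) - f (a, b + h n) - f (a + h n, b) + f (a, b)
       = (h n)\<^sup>2 * partial_y (partial_x f) (x', y')"
      using mixed_difference_quotient[OF f h(1)] .
    have "(h n)\<^sup>2 * partial_x (partial_y f) (y, x) = (h n)\<^sup>2 * partial_y (partial_x f) (x', y')"
      using 1(5) 2(5) unfolding partials_swap o_apply swap_simp by linarith
    with h(1)[of n] have "partial_x (partial_y f) (y, x) = partial_y (partial_x f) (x', y')" by simp
    with 1 2 show ?thesis by (intro exI[of _ "(y, x)"] exI[of _ "(x', y')"]) auto
  qed
  then obtain P Q where
    P: "\<And>n. P n \<in> {a<..<a + h n} \<times> {b<..<b + h n}" and
    Q: "\<And>n. Q n \<in> {a<..<a + h n} \<times> {b<..<b + h n}" and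
    eq: "\<And>n. partial_x (partial_y f) (P n) = partial_y (partial_x f) (Q n)"
    by metis
  have squeeze: "z \<longlonglongrightarrow> c" if "\<And>n. z n \<in> {c<..<c + h n}" for z and c :: real
  proof (rule real_tendsto_sandwich[of "\<lambda>_. c" z _ "\<lambda>n. c + h n"])
    show "(\<lambda>n. c + h n) \<longlonglongrightarrow> c" using tendsto_add[OF tendsto_const h(2), of c] by simp
  qed (use that in \<open>auto intro!: always_eventually less_imp_le\<close>)
  have lim: "(\<lambda>n. g (R n)) \<longlonglongrightarrow> g (a, b)"
    if R: "\<And>n. R n \<in> {a<..<a + h n} \<times> {b<..<b + h n}" and g: "continuous_on UNIV g"
    for g :: "real \<times> real \<Rightarrow> real" and R
  proof (rule continuous_on_tendsto_compose[OF g])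
    have "(\<lambda>n. (fst (R n), snd (R n))) \<longlonglongrightarrow> (a, b)"
      using R by (intro tendsto_Pair squeeze) (auto simp: mem_Times_iff)
    then show "R \<longlonglongrightarrow> (a, b)" by simp
  qed auto
  have "(\<lambda>n. partial_x (partial_y f) (P n)) \<longlonglongrightarrow> partial_x (partial_y f) (a, b)"
    using f' by (intro lim[OF P] C_bounded_continuous[of _ 0] C_bounded_partials)
  moreover have "(\<lambda>n. partial_x (partial_y f) (P n)) \<longlonglongrightarrow> partial_y (partial_x f) (a, b)"
    unfolding eq
    using f' by (intro lim[OF Q] C_bounded_continuous[of _ 0] C_bounded_partials)
  ultimately show "partial_x (partial_y f) p = partial_y (partial_x f) p"
    unfolding p by (rule LIMSEQ_unique)
qed

section \<open>Taylor's formula with Lagrange remainder on a segment\<close>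

text \<open>
  One-dimensional Taylor expansion of \<open>t \<mapsto> f (a + t * h, b + t * k)\<close> at \<open>0\<close>, evaluated at \<open>1\<close>.
\<close>
lemma Taylor_Lagrange:
  assumes f: "f \<in> C_bounded 2"
  shows "\<exists>t\<in>{0<..<1}. f (a + h, b + k) = f (a, b) + partial_x f (a, b) * h + partial_y f (a, b) * k
    + 1 / 2 * second_differential f (a + t * h, b + t * k) h k"
proof -
  have f': "f \<in> C_bounded (Suc (Suc 0))" using f by (simp only: numeral_2_eq_2)
  have along: "((\<lambda>t. g (a + t * h, b + t * k)) has_real_derivative
      partial_x g (a + t * h, b + t * k) * h + partial_y g (a + t * h, b + t * k) * k) (at t)"
    if g: "g \<in> C_bounded (Suc r)" for g r and t :: real
  proof -
    have "((\<lambda>t. (a + t * h, b + t * k)) has_derivative (\<lambda>s. (s * h, s * k))) (at t)"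
      by (auto intro!: derivative_eq_intros)
    from diff_chain_at[OF this C_bounded_has_derivative[OF g]]
    have "((\<lambda>t. g (a + t * h, b + t * k)) has_derivative
       (\<lambda>s. partial_x g (a + t * h, b + t * k) * (s * h) + partial_y g (a + t * h, b + t * k) * (s * k))) (at t)"
      by (simp add: o_def)
    then show ?thesis
      by (rule has_derivative_imp_has_field_derivative) (simp add: algebra_simps)
  qed
  define \<phi> where "\<phi> m t = (if m = 0 then f (a + t * h, b + t * k)
    else if m = 1 then partial_x f (a + t * h, b + t * k) * h + partial_y f (a + t * h, b + t * k) * k
    else second_differential f (a + t * h, b + t * k) h k)" for m :: nat and t
  have "\<exists>t::real. 0 < t \<and> t < 1 \<and>
      \<phi> 0 1 = (\<Sum>m<2. (\<phi> m 0 / fact m) * 1 ^ m) + (\<phi> 2 t / fact 2) * 1 ^ 2"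
  proof (rule Maclaurin)
    show "\<forall>m t. m < 2 \<and> 0 \<le> t \<and> t \<le> 1 \<longrightarrow> (\<phi> m has_real_derivative \<phi> (Suc m) t) (at t)"
    proof (intro allI impI)
      fix m :: nat and t :: real
      assume "m < 2 \<and> 0 \<le> t \<and> t \<le> 1"
      then consider "m = 0" | "m = 1" by linarith
      then show "(\<phi> m has_real_derivative \<phi> (Suc m) t) (at t)"
      proof cases
        case 1
        then show ?thesis using along[OF f'] by (simp add: \<phi>_def [abs_def])
      next
        case 2
        have "((\<lambda>t. partial_x f (a + t * h, b + t * k) * h + partial_y f (a + t * h, b + t * k) * k)
            has_real_derivative second_differential f (a + t * h, b + t * k) h k) (at t)"
          by (rule DERIV_cong[OF DERIV_add[OF DERIV_cmult_right DERIV_cmult_right]],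
              rule along[OF C_bounded_partials(1)[OF f']], rule along[OF C_bounded_partials(2)[OF f']])
            (simp add: second_differential_def mixed_partials_commute[OF f] power2_eq_square algebra_simps)
        with 2 show ?thesis by (simp add: \<phi>_def [abs_def])
      qed
    qed
  qed auto
  then obtain t where "0 < t" "t < 1" "\<phi> 0 1 = (\<Sum>m<2. (\<phi> m 0 / fact m) * 1 ^ m) + (\<phi> 2 t / fact 2) * 1 ^ 2"
    by blast
  then show ?thesis by (intro bexI[of _ t]) (auto simp: \<phi>_def numeral_2_eq_2)
qed

section \<open>Measurable choice of the intermediate point\<close>

text \<open>
  The least zero is a measurable choice because it is lower semicontinuous: it is at most \<open>c\<close>
  exactly when some zero lies in the compact interval \<open>[0, c]\<close>, and projecting a closed set along a
  compact factor gives a closed set.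
\<close>
lemma measurable_least_zero:
  fixes H :: "'a::euclidean_space \<times> real \<Rightarrow> real"
  assumes H: "continuous_on UNIV H" and ex: "\<And>p. \<exists>s\<ge>0. H (p, s) = 0"
  obtains d where "d \<in> borel_measurable borel" "\<And>p. 0 \<le> d p" "\<And>p. H (p, d p) = 0"
    "\<And>p s. 0 \<le> s \<Longrightarrow> H (p, s) = 0 \<Longrightarrow> d p \<le> s"
proof -
  define Z where "Z p = {s. 0 \<le> s \<and> H (p, s) = 0}" for p
  define d where "d p = Inf (Z p)" for p
  have Z: "Z p \<noteq> {}" "bdd_below (Z p)" for p
    using ex[of p] by (auto simp: Z_def intro!: bdd_belowI[of _ 0])
  have "closed (Z p)" for p
  proof -
    have "closed ({0..} \<inter> (\<lambda>s. H (p, s)) -` {0})"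
      by (intro closed_Int closed_vimage continuous_on_compose2[OF H] continuous_intros) auto
    then show ?thesis by (simp add: Z_def Int_def vimage_def)
  qed
  then have dZ: "d p \<in> Z p" for p
    using closed_contains_Inf[OF Z] by (simp add: d_def)
  have least: "d p \<le> s" if "s \<in> Z p" for p s
    unfolding d_def using that Z(2) by (rule cInf_lower)
  have "closed {p. d p \<le> c}" for c
  proof -
    have "closed {p. \<exists>s. s \<in> {0..c} \<and> (s, p) \<in> (\<lambda>(s, p). H (p, s)) -` {0}}"
      by (intro closed_compact_projection closed_vimage)
        (auto simp: case_prod_unfold intro!: continuous_on_compose2[OF H] continuous_intros)
    also have "{p. \<exists>s. s \<in> {0..c} \<and> (s, p) \<in> (\<lambda>(s, p). H (p, s)) -` {0}} = {p. d p \<le> c}"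
      using dZ least by (fastforce simp: Z_def)
    finally show ?thesis .
  qed
  then have "d \<in> borel_measurable borel"
    by (simp add: borel_measurable_iff_le)
  then show thesis using that dZ least by (auto simp: Z_def)
qed

text \<open>
  The open interval is not compact, so a least zero in it need not exist. A zero closest to the
  midpoint does: it is obtained by applying the previous lemma to
  \<open>H (p, s) = F (p, 1/2 + s) * F (p, 1/2 - s)\<close>, which vanishes at \<open>s \<ge> 0\<close> if and only if \<open>F\<close> has a
  zero at distance \<open>s\<close> from the midpoint. A further test, measurable in \<open>p\<close>, tells on which side
  it lies.
\<close>
lemma measurable_zero_in_interval:
  fixes F :: "'a::euclidean_space \<times> real \<Rightarrow> real"
  assumes F: "continuous_on UNIV F" and ex: "\<And>p. \<exists>t\<in>{0<..<1}. F (p, t) = 0"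
  obtains \<tau> where "\<tau> \<in> borel_measurable borel" "\<And>p. 0 < \<tau> p" "\<And>p. \<tau> p < 1" "\<And>p. F (p, \<tau> p) = 0"
proof -
  define H where "H = (\<lambda>(p, s). F (p, 1/2 + s) * F (p, 1/2 - s))"
  have H: "continuous_on UNIV H"
    unfolding H_def case_prod_unfold
    by (intro continuous_intros continuous_on_compose2[OF F]) auto
  have ex': "\<exists>s. 0 \<le> s \<and> s < 1/2 \<and> H (p, s) = 0" for p
  proof -
    obtain t where t: "0 < t" "t < 1" "F (p, t) = 0" using ex[of p] by auto
    then show ?thesis
      by (cases "t \<ge> 1/2") (auto simp: H_def intro: exI[of _ "t - 1/2"] exI[of _ "1/2 - t"])
  qed
  then obtain d where d: "d \<in> borel_measurable borel" "\<And>p. 0 \<le> d p" "\<And>p. H (p, d p) = 0"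
    "\<And>p s. 0 \<le> s \<Longrightarrow> H (p, s) = 0 \<Longrightarrow> d p \<le> s"
    using measurable_least_zero[OF H] by metis
  have half: "d p < 1/2" for p using ex'[of p] d(4) by force
  define \<tau> where "\<tau> p = (if F (p, 1/2 + d p) = 0 then 1/2 + d p else 1/2 - d p)" for p
  have "F \<in> borel_measurable borel" using F by (rule borel_measurable_continuous_onI)
  moreover have "(\<lambda>p. (p, 1/2 + d p)) \<in> borel \<rightarrow>\<^sub>M borel"
    unfolding borel_prod[symmetric] using d(1) by measurable
  ultimately have "(\<lambda>p. F (p, 1/2 + d p)) \<in> borel_measurable borel"
    by (rule measurable_compose[rotated])
  then have "\<tau> \<in> borel_measurable borel"
    unfolding \<tau>_def using d(1) by measurable
  moreover have "0 < \<tau> p" "\<tau> p < 1" "F (p, \<tau> p) = 0" for p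
    using d(2,3)[of p] half[of p] by (auto simp: \<tau>_def H_def)
  ultimately show thesis using that by blast
qed

text \<open>
  The intermediate point is \<open>c + \<tau> p * (p - c)\<close>. At \<open>p = c\<close> every parameter is admissible, so a
  parameter exists on the whole plane, and the measurable choice of zeros applies there.
\<close>
lemma measurable_Taylor_parameter:
  assumes f: "f \<in> C_bounded 2"
  shows "\<exists>\<tau> :: real \<times> real \<Rightarrow> real. \<tau> \<in> borel_measurable borel \<and> (\<forall>p. 0 < \<tau> p \<and> \<tau> p < 1) \<and>
    (\<forall>u v. f (u, v) = f c + partial_x f c * (u - fst c) + partial_y f c * (v - snd c) +
      1 / fact 2 * second_differential f (fst c + \<tau> (u, v) * (u - fst c), snd c + \<tau> (u, v) * (v - snd c))
        (u - fst c) (v - snd c))"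
proof -
  have f2: "f \<in> C_bounded (Suc (Suc 0))" using f by (simp only: numeral_2_eq_2)
  define F where "F = (\<lambda>(p, t). f c + partial_x f c * (fst p - fst c) + partial_y f c * (snd p - snd c) +
      1 / 2 * second_differential f (fst c + t * (fst p - fst c), snd c + t * (snd p - snd c))
        (fst p - fst c) (snd p - snd c) - f p)"
  have cont: "continuous_on UNIV (\<lambda>z. g (z' z))" if "g \<in> C_bounded r" "continuous_on UNIV z'"
    for g r and z' :: "(real \<times> real) \<times> real \<Rightarrow> real \<times> real"
    using continuous_on_compose2[OF C_bounded_continuous[OF that(1), of UNIV] that(2)] by simp
  note C_bounded_partials[OF f2]
  note second = C_bounded_partials[OF this(1)] C_bounded_partials[OF this(2)]
  have "continuous_on UNIV F"
    unfolding F_def case_prod_unfold second_differential_def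
    by (intro continuous_intros cont[OF f] cont[OF second(1)] cont[OF second(2)] cont[OF second(4)])
  moreover have "\<exists>t\<in>{0<..<1}. F (p, t) = 0" for p
    using Taylor_Lagrange[OF f, of "fst c" "fst p - fst c" "snd c" "snd p - snd c"]
    by (fastforce simp: F_def)
  ultimately obtain \<tau> where \<tau>: "\<tau> \<in> borel_measurable borel" "\<And>p. 0 < \<tau> p" "\<And>p. \<tau> p < 1" "\<And>p. F (p, \<tau> p) = 0"
    using measurable_zero_in_interval[of F] by metis
  have "f (u, v) = f c + partial_x f c * (u - fst c) + partial_y f c * (v - snd c) +
      1 / fact 2 * second_differential f (fst c + \<tau> (u, v) * (u - fst c), snd c + \<tau> (u, v) * (v - snd c))
        (u - fst c) (v - snd c)" for u v
    using \<tau>(4)[of "(u, v)"] by (simp add: F_def)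
  with \<tau> show ?thesis by blast
qed

section \<open>Absolute summability of the shifted kernel\<close>

text \<open>
  If \<open>\<bar>u - k\<bar> \<ge> 1\<close> or \<open>\<bar>v - j\<bar> \<ge> 1\<close>, then \<open>\<bar>u - k\<bar> ^ \<eta> + \<bar>v - j\<bar> ^ \<eta> \<ge> 1\<close>, so the two moments with exponents
  \<open>(\<eta>, 0)\<close> and \<open>(0, \<eta>)\<close> dominate the sum over these indices. Both are finite since the maximal
  moment of order \<open>\<eta>\<close> ranges over all splittings of \<open>\<eta>\<close>. The other indices are finite in number.
\<close>
lemma sampling_kernel_abs_summable:
  assumes "sampling_kernel \<kappa>"
  shows "(\<lambda>(k, j). \<bar>\<kappa> (u - of_int k, v - of_int j)\<bar>) summable_on UNIV"
proof -
  obtain p1 p2 where finite_max: "max_abs_moment \<kappa> (p1 + p2) < \<infinity>"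
    using assms by (auto simp: sampling_kernel_def)
  define \<eta> where "\<eta> = p1 + p2"
  have fin: "abs_moment \<kappa> q1 q2 < \<infinity>" if "q1 + q2 = \<eta>" for q1 q2
  proof -
    have "{abs_moment \<kappa> p1 p2 | p1 p2. p1 + p2 = \<eta>} \<subseteq> (\<lambda>(p1, p2). abs_moment \<kappa> p1 p2) ` ({..\<eta>} \<times> {..\<eta>})"
      by auto
    then have "finite {abs_moment \<kappa> p1 p2 | p1 p2. p1 + p2 = \<eta>}"
      by (rule finite_subset) auto
    then have "abs_moment \<kappa> q1 q2 \<le> max_abs_moment \<kappa> \<eta>"
      unfolding max_abs_moment_def using that by (intro Max_ge) auto
    with finite_max show ?thesis by (simp add: \<eta>_def)
  qed
  have moment: "(\<lambda>(k, j). \<bar>\<kappa> (u - of_int k, v - of_int j)\<bar> * \<bar>u - of_int k\<bar> ^ q1 * \<bar>v - of_int j\<bar> ^ q2)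
      summable_on UNIV" (is "?g summable_on _") if q: "q1 + q2 = \<eta>" for q1 q2
  proof (rule nonneg_bdd_above_summable_on)
    obtain M where M: "0 \<le> M" "abs_moment \<kappa> q1 q2 = ennreal M"
      using fin[OF q] by (cases "abs_moment \<kappa> q1 q2") auto
    \<comment> \<open>The moment is an iterated sum; enclosing \<open>F\<close> in a rectangle bounds every partial sum by it.\<close>
    have "sum ?g F \<le> M" if F: "finite F" for F
    proof -
      have "ennreal (sum ?g F) \<le> ennreal (sum ?g (fst ` F \<times> snd ` F))"
        using F by (intro ennreal_leI sum_mono2) (auto simp: subset_fst_snd)
      also have "\<dots> = (\<Sum>k\<in>fst ` F. \<Sum>j\<in>snd ` F. ennreal (?g (k, j)))"
        by (subst sum.cartesian_product) (auto simp: case_prod_unfold intro!: sum_ennreal[symmetric])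
      also have "\<dots> \<le> (\<Sum>k\<in>fst ` F. \<Sum>\<^sub>\<infinity>j. ennreal (?g (k, j)))"
      proof (rule sum_mono)
        fix k
        have "infsum (\<lambda>j. ennreal (?g (k, j))) (snd ` F) \<le> infsum (\<lambda>j. ennreal (?g (k, j))) UNIV"
          by (rule infsum_mono_neutral) (auto intro: nonneg_summable_on_complete)
        then show "(\<Sum>j\<in>snd ` F. ennreal (?g (k, j))) \<le> (\<Sum>\<^sub>\<infinity>j. ennreal (?g (k, j)))"
          using F by simp
      qed
      also have "\<dots> \<le> (\<Sum>\<^sub>\<infinity>k. \<Sum>\<^sub>\<infinity>j. ennreal (?g (k, j)))"
      proof -
        have "infsum (\<lambda>k. \<Sum>\<^sub>\<infinity>j. ennreal (?g (k, j))) (fst ` F) \<le> infsum (\<lambda>k. \<Sum>\<^sub>\<infinity>j. ennreal (?g (k, j))) UNIV"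
          by (rule infsum_mono_neutral) (auto intro: nonneg_summable_on_complete)
        then show ?thesis using F by simp
      qed
      also have "\<dots> \<le> ennreal M"
        unfolding M(2)[symmetric] abs_moment_def by (rule SUP_upper2[of "(u, v)"]) auto
      finally show ?thesis
        using M(1) by (simp add: ennreal_le_iff)
    qed
    then show "bdd_above (sum ?g ` {F. F \<subseteq> UNIV \<and> finite F})"
      by (intro bdd_aboveI) auto
  qed auto
  define near where "near = {k::int. \<bar>u - of_int k\<bar> < 1} \<times> {j::int. \<bar>v - of_int j\<bar> < 1}"
  have "{k::int. \<bar>x - of_int k\<bar> < 1} \<subseteq> {\<lfloor>x\<rfloor> .. \<lceil>x\<rceil>}" for x :: real
    by auto linarith+
  then have "finite {k::int. \<bar>x - of_int k\<bar> < 1}" for x :: real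
    by (rule finite_subset) auto
  then have "finite near" by (auto simp: near_def)
  have "(\<lambda>(k, j). \<bar>\<kappa> (u - of_int k, v - of_int j)\<bar>) summable_on (- near)"
  proof (rule summable_on_comparison_test)
    show "(\<lambda>p. (case p of (k, j) \<Rightarrow> \<bar>\<kappa> (u - of_int k, v - of_int j)\<bar> * \<bar>u - of_int k\<bar> ^ \<eta> * \<bar>v - of_int j\<bar> ^ 0) +
        (case p of (k, j) \<Rightarrow> \<bar>\<kappa> (u - of_int k, v - of_int j)\<bar> * \<bar>u - of_int k\<bar> ^ 0 * \<bar>v - of_int j\<bar> ^ \<eta>)) summable_on (- near)"
      by (rule summable_on_subset_banach[OF summable_on_add[OF moment moment]]) auto
    fix p assume p: "p \<in> - near"
    obtain k j where kj: "p = (k, j)" by fastforce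
    have "1 \<le> \<bar>u - of_int k\<bar> ^ \<eta> + \<bar>v - of_int j\<bar> ^ \<eta>"
    proof (cases "\<bar>u - of_int k\<bar> < 1")
      case True
      then have "1 \<le> \<bar>v - of_int j\<bar> ^ \<eta>" using p by (auto simp: near_def kj one_le_power)
      then show ?thesis by (simp add: add_increasing)
    next
      case False
      then have "1 \<le> \<bar>u - of_int k\<bar> ^ \<eta>" by (auto simp: one_le_power)
      then show ?thesis by (simp add: add_increasing2)
    qed
    from mult_left_mono[OF this abs_ge_zero[of "\<kappa> (u - of_int k, v - of_int j)"]]
    show "(case p of (k, j) \<Rightarrow> \<bar>\<kappa> (u - of_int k, v - of_int j)\<bar>) \<le>
        (case p of (k, j) \<Rightarrow> \<bar>\<kappa> (u - of_int k, v - of_int j)\<bar> * \<bar>u - of_int k\<bar> ^ \<eta> * \<bar>v - of_int j\<bar> ^ 0) +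
        (case p of (k, j) \<Rightarrow> \<bar>\<kappa> (u - of_int k, v - of_int j)\<bar> * \<bar>u - of_int k\<bar> ^ 0 * \<bar>v - of_int j\<bar> ^ \<eta>)"
      by (simp add: kj algebra_simps)
  qed auto
  then have "(\<lambda>(k, j). \<bar>\<kappa> (u - of_int k, v - of_int j)\<bar>) summable_on (- near \<union> near)"
    by (intro summable_on_union summable_on_finite[OF \<open>finite near\<close>])
  then show ?thesis by simp
qed

section \<open>Means over a cell\<close>

lemma cell_mean_cong:
  assumes "\<And>u v. (u, v) \<in> cell w k j \<Longrightarrow> h u v = h' u v"
  shows "cell_mean w k j h = cell_mean w k j h'"
  unfolding cell_mean_def
  by (auto simp: assms cell_def intro!: set_lebesgue_integral_cong)

lemma continuous_imp_set_integrable_cell: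
  fixes g :: "real \<times> real \<Rightarrow> real"
  assumes "continuous_on UNIV g"
  shows "set_integrable lborel (cell w k j) g"
proof (rule set_integrable_subset)
  let ?K = "{of_int k / w..(of_int k + 1) / w} \<times> {of_int j / w..(of_int j + 1) / w}"
  show "set_integrable lborel ?K g"
    unfolding set_integrable_def
    by (intro borel_integrable_compact compact_Times compact_Icc continuous_on_subset[OF assms]) auto
  show "cell w k j \<subseteq> ?K" by (auto simp: cell_def)
  have "open (cell w k j)" by (simp add: cell_def open_Times)
  then show "cell w k j \<in> sets lborel" by simp
qed

text \<open>
  Fubini's theorem. Linearity and monotonicity of the mean thus come from those of a single integral
  over the cell.
\<close>
lemma cell_mean_eq_set_integral:
  fixes g :: "real \<times> real \<Rightarrow> real"
  assumes "continuous_on UNIV g"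
  shows "cell_mean w k j (\<lambda>u v. g (u, v)) = w\<^sup>2 * (LINT p:cell w k j|lborel. g p)"
proof -
  have "integrable (lborel \<Otimes>\<^sub>M lborel) (\<lambda>p. indicator (cell w k j) p *\<^sub>R g p)"
    using continuous_imp_set_integrable_cell[OF assms] by (simp add: set_integrable_def lborel_prod)
  from lborel_pair.integral_fst'[OF this] show ?thesis
    by (simp add: cell_mean_def set_lebesgue_integral_def lborel_prod cell_def indicator_times mult.assoc)
qed

lemma cell_mean_diff:
  fixes g h :: "real \<times> real \<Rightarrow> real"
  assumes "continuous_on UNIV g" "continuous_on UNIV h"
  shows "cell_mean w k j (\<lambda>u v. g (u, v) - h (u, v)) =
    cell_mean w k j (\<lambda>u v. g (u, v)) - cell_mean w k j (\<lambda>u v. h (u, v))"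
  using assms cell_mean_eq_set_integral[of "\<lambda>p. g p - h p"]
  by (simp add: cell_mean_eq_set_integral continuous_intros continuous_imp_set_integrable_cell
      right_diff_distrib)

lemma cell_mean_mult: "cell_mean w k j (\<lambda>u v. c * h u v) = c * cell_mean w k j h"
  by (simp add: cell_mean_def)

lemma set_integral_edge_const:
  "0 < w \<Longrightarrow> (LBINT u:{of_int k / w<..<(of_int k + 1) / w}. c) = c / (w::real)" for c :: real
  by (subst set_integral_const) (auto simp: divide_right_mono diff_divide_distrib[symmetric])

lemma set_integral_edge_offset:
  assumes w: "0 < (w::real)"
  shows "(LBINT u:{of_int k / w<..<(of_int k + 1) / w}. u - of_int k / w) = 1 / (2 * w\<^sup>2)"
proof -
  let ?a = "of_int k / w" and ?b = "(of_int k + 1) / w"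
  have ab: "?b = ?a + 1 / w" by (simp add: add_divide_distrib)
  have "set_integrable lborel {?a<..<?b} (\<lambda>u. u - ?a)"
    by (rule set_integrable_subset[OF borel_integrable_atLeastAtMost'[of ?a ?b]])
       (auto intro!: continuous_intros)
  then have "(LBINT u:{?a<..<?b}. u - ?a) = integral {?a<..<?b} (\<lambda>u. u - ?a)"
    by (rule set_borel_integral_eq_integral)
  also have "\<dots> = integral {?a..?b} (\<lambda>u. u - ?a)"
    by (rule integral_open_interval_real[symmetric])
  also have "\<dots> = (?b - ?a)\<^sup>2 / 2 - (?a - ?a)\<^sup>2 / 2"
    using w by (intro integral_unique fundamental_theorem_of_calculus)
      (auto simp: ab has_real_derivative_iff_has_vector_derivative[symmetric] intro!: derivative_eq_intros)
  finally show ?thesis by (simp add: ab power_divide)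
qed

lemma cell_mean_const: "0 < w \<Longrightarrow> cell_mean w k j (\<lambda>u v. c) = c"
  by (simp add: cell_mean_def set_integral_edge_const power2_eq_square)

lemma cell_mean_offset:
  assumes "0 < w"
  shows "cell_mean w k j (\<lambda>u v. u - of_int k / w) = 1 / (2 * w)"
    and "cell_mean w k j (\<lambda>u v. v - of_int j / w) = 1 / (2 * w)"
  using assms
  by (simp_all add: cell_mean_def set_integral_edge_const set_integral_edge_offset power2_eq_square
      del: set_integral_diff)

lemma abs_cell_mean_le:
  fixes g :: "real \<times> real \<Rightarrow> real"
  assumes w: "0 < w" and g: "continuous_on UNIV g" and B: "\<And>p. \<bar>g p\<bar> \<le> B"
  shows "\<bar>cell_mean w k j (\<lambda>u v. g (u, v))\<bar> \<le> B"
proof -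
  have mono: "cell_mean w k j (\<lambda>u v. g1 (u, v)) \<le> cell_mean w k j (\<lambda>u v. g2 (u, v))"
    if "continuous_on UNIV g1" "continuous_on UNIV g2" "\<And>p. g1 p \<le> g2 p"
    for g1 g2 :: "real \<times> real \<Rightarrow> real"
    unfolding cell_mean_eq_set_integral[OF that(1)] cell_mean_eq_set_integral[OF that(2)]
    using that by (intro mult_left_mono set_integral_mono continuous_imp_set_integrable_cell) auto
  have "g p \<le> B" "- B \<le> g p" for p using B[of p] by auto
  with mono[OF g, of "\<lambda>_. B"] mono[OF _ g, of "\<lambda>_. - B"] show ?thesis
    by (simp add: cell_mean_const[OF w])
qed

text \<open>
  On the cell the Taylor formula determines the second differential at the intermediate point as
  twice the difference of \<open>f\<close> and its first-order Taylor polynomial, so the mean does not depend on how the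
  intermediate point was chosen, and the integrand is continuous in \<open>(u, v)\<close> even if \<open>q\<close> is not.
\<close>
lemma cell_mean_Taylor_remainder:
  assumes w: "0 < w" and f: "continuous_on UNIV f"
    and q: "\<And>u v. (u, v) \<in> cell w k j \<Longrightarrow> taylor_point f (of_int k / w) (of_int j / w) u v (q u v)"
  shows "cell_mean w k j (\<lambda>u v. second_differential f (q u v) (u - of_int k / w) (v - of_int j / w)) =
    2 * (cell_mean w k j (\<lambda>u v. f (u, v)) - f (of_int k / w, of_int j / w)
      - 1 / (2 * w) * partial_x f (of_int k / w, of_int j / w)
      - 1 / (2 * w) * partial_y f (of_int k / w, of_int j / w))"
proof -
  let ?a = "of_int k / w" and ?b = "of_int j / w"
  define g1 where "g1 p = partial_x f (?a, ?b) * (fst p - ?a)" for p :: "real \<times> real"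
  define g2 where "g2 p = partial_y f (?a, ?b) * (snd p - ?b)" for p :: "real \<times> real"
  have cont: "continuous_on UNIV g1" "continuous_on UNIV g2"
    unfolding g1_def g2_def by (intro continuous_intros)+
  have "cell_mean w k j (\<lambda>u v. second_differential f (q u v) (u - ?a) (v - ?b)) =
    cell_mean w k j (\<lambda>u v. 2 * (f (u, v) - f (?a, ?b) - g1 (u, v) - g2 (u, v)))"
    by (rule cell_mean_cong) (use q in \<open>auto simp: taylor_point_def g1_def g2_def\<close>)
  also have "\<dots> = 2 * (cell_mean w k j (\<lambda>u v. f (u, v)) - cell_mean w k j (\<lambda>u v. f (?a, ?b))
      - cell_mean w k j (\<lambda>u v. g1 (u, v)) - cell_mean w k j (\<lambda>u v. g2 (u, v)))"
    using cell_mean_diff[of "\<lambda>p. f p - f (?a, ?b) - g1 p" g2 w k j]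
      cell_mean_diff[of "\<lambda>p. f p - f (?a, ?b)" g1 w k j] cell_mean_diff[of f "\<lambda>p. f (?a, ?b)" w k j]
    unfolding cell_mean_mult by (simp add: cont f continuous_intros)
  also have "cell_mean w k j (\<lambda>u v. g1 (u, v)) = 1 / (2 * w) * partial_x f (?a, ?b)"
    by (simp add: g1_def cell_mean_mult cell_mean_offset[OF w])
  also have "cell_mean w k j (\<lambda>u v. g2 (u, v)) = 1 / (2 * w) * partial_y f (?a, ?b)"
    by (simp add: g2_def cell_mean_mult cell_mean_offset[OF w])
  finally show ?thesis by (simp add: cell_mean_const[OF w])
qed

section \<open>Absolutely convergent double series\<close>

lemma abs_convergent_iff_summable: "abs_convergent a \<longleftrightarrow> (\<lambda>(k, j). a k j) summable_on UNIV"
  using summable_on_iff_abs_summable_on_real[of "\<lambda>(k, j). a k j" UNIV]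
  by (simp add: abs_convergent_def case_prod_unfold)

lemma double_series_eq_infsum:
  "abs_convergent a \<Longrightarrow> double_series a = (\<Sum>\<^sub>\<infinity>(k, j). a k j)"
  using infsum_Sigma'_banach[of a UNIV "\<lambda>_. UNIV"]
  by (simp add: abs_convergent_iff_summable double_series_def)

lemma abs_convergent_cmult:
  assumes "abs_convergent a"
  shows "abs_convergent (\<lambda>k j. c * a k j)"
  using assms unfolding abs_convergent_iff_summable case_prod_unfold
  by (rule summable_on_cmult_right)

lemma double_series_cmult:
  assumes a: "abs_convergent a"
  shows "double_series (\<lambda>k j. c * a k j) = c * double_series a"
  unfolding double_series_eq_infsum[OF a] double_series_eq_infsum[OF abs_convergent_cmult[OF a]]
    case_prod_unfold
  by (rule infsum_cmult_right')

lemma abs_convergent_add: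
  assumes "abs_convergent a" "abs_convergent b"
  shows "abs_convergent (\<lambda>k j. a k j + b k j)"
  using assms unfolding abs_convergent_iff_summable case_prod_unfold
  by (rule summable_on_add)

lemma double_series_add:
  assumes a: "abs_convergent a" and b: "abs_convergent b"
  shows "double_series (\<lambda>k j. a k j + b k j) = double_series a + double_series b"
  unfolding double_series_eq_infsum[OF a] double_series_eq_infsum[OF b]
    double_series_eq_infsum[OF abs_convergent_add[OF a b]] case_prod_unfold
  using a b unfolding abs_convergent_iff_summable case_prod_unfold
  by (rule infsum_add)

lemma abs_convergent_bounded_factor:
  assumes a: "abs_convergent a" and c: "\<And>k j. \<bar>c k j\<bar> \<le> B"
  shows "abs_convergent (\<lambda>k j. a k j * c k j)"
  unfolding abs_convergent_def
proof (rule summable_on_comparison_test)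
  show "(\<lambda>p. (case p of (k, j) \<Rightarrow> \<bar>a k j\<bar>) * B) summable_on UNIV"
    using a unfolding abs_convergent_def by (rule summable_on_cmult_left)
  fix p :: "int \<times> int"
  show "(case p of (k, j) \<Rightarrow> \<bar>a k j * c k j\<bar>) \<le> (case p of (k, j) \<Rightarrow> \<bar>a k j\<bar>) * B"
    unfolding case_prod_unfold abs_mult by (rule mult_left_mono[OF c abs_ge_zero])
  show "0 \<le> (case p of (k, j) \<Rightarrow> \<bar>a k j * c k j\<bar>)" 
    by (simp add: case_prod_unfold)
qed

section \<open>The series identity\<close>

lemma cell_point_between:
  assumes "(u, v) \<in> cell w k j" "0 < t" "t < 1"
  shows "(of_int k / w + t * (u - of_int k / w), of_int j / w + t * (v - of_int j / w)) \<in> cell w k j"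
    and "(of_int k / w + t * (u - of_int k / w), of_int j / w + t * (v - of_int j / w)) \<in>
      open_segment (of_int k / w, of_int j / w) (u, v)"
proof -
  have between: "a < a + t * (z - a) \<and> a + t * (z - a) < b" if "a < z" "z < b" for a z b :: real
  proof -
    have "0 < t * (z - a)" "t * (z - a) < 1 * (z - a)"
      using that assms by (auto intro: mult_strict_right_mono)
    then have "t * (z - a) < z - a" by simp
    with that \<open>0 < t * (z - a)\<close> show ?thesis by linarith
  qed
  show "(of_int k / w + t * (u - of_int k / w), of_int j / w + t * (v - of_int j / w)) \<in> cell w k j"
    using assms(1) unfolding cell_def mem_Times_iff fst_conv snd_conv greaterThanLessThan_iff
    by (blast dest: between)
  show "(of_int k / w + t * (u - of_int k / w), of_int j / w + t * (v - of_int j / w)) \<in>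
      open_segment (of_int k / w, of_int j / w) (u, v)"
    unfolding in_segment
  proof (intro conjI exI[of _ t])
    have affine: "a + t * (z - a) = (1 - t) *\<^sub>R a + t *\<^sub>R z" for a z :: real
      by (simp add: algebra_simps)
    show "(of_int k / w + t * (u - of_int k / w), of_int j / w + t * (v - of_int j / w)) =
        (1 - t) *\<^sub>R (of_int k / w, of_int j / w) + t *\<^sub>R (u, v)"
      unfolding affine by simp
  qed (use assms in \<open>auto simp: cell_def\<close>)
qed

theorem theorem3:
  fixes \<kappa> f :: "real \<times> real \<Rightarrow> real"
  assumes "sampling_kernel \<kappa>" and "f \<in> C_bounded 2"
  shows "\<exists>\<theta>1 \<theta>2 :: real \<Rightarrow> int \<Rightarrow> int \<Rightarrow> real \<times> real \<Rightarrow> real. \<forall>w>0.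
    (\<forall>k j.
       \<theta>1 w k j \<in> borel_measurable (restrict_space borel (cell w k j)) \<and>
       \<theta>2 w k j \<in> borel_measurable (restrict_space borel (cell w k j)) \<and>
       (\<forall>(u, v)\<in>cell w k j.
          of_int k / w < \<theta>1 w k j (u, v) \<and> \<theta>1 w k j (u, v) < (of_int k + 1) / w \<and>
          of_int j / w < \<theta>2 w k j (u, v) \<and> \<theta>2 w k j (u, v) < (of_int j + 1) / w \<and>
          taylor_point f (of_int k / w) (of_int j / w) u v
            (\<theta>1 w k j (u, v), \<theta>2 w k j (u, v)))) \<and>
    (\<forall>x y.
       abs_convergent (S_term \<kappa> w f x y) \<and>
       abs_convergent (G_term \<kappa> w f x y) \<and>
       abs_convergent (G_term \<kappa> w (partial_x f) x y) \<and>
       abs_convergent (G_term \<kappa> w (partial_y f) x y) \<and>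
       abs_convergent (R_term \<kappa> w f \<theta>1 \<theta>2 x y) \<and>
       S_op \<kappa> w f x y =
         G_op \<kappa> w f x y + 1 / (2 * w) * G_op \<kappa> w (partial_x f) x y
         + 1 / (2 * w) * G_op \<kappa> w (partial_y f) x y
         + 1 / fact 2 * double_series (R_term \<kappa> w f \<theta>1 \<theta>2 x y))"
proof -
  have f2: "f \<in> C_bounded (Suc (Suc 0))" using assms(2) by (simp only: numeral_2_eq_2)
  have cont: "continuous_on UNIV f" using C_bounded_continuous[OF assms(2)] .
  obtain \<tau> where \<tau>: "\<And>c. \<tau> c \<in> borel_measurable borel" "\<And>c p. 0 < \<tau> c p" "\<And>c p. \<tau> c p < 1"
    "\<And>a b u v. f (u, v) = f (a, b) + partial_x f (a, b) * (u - a) + partial_y f (a, b) * (v - b) +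
      1 / fact 2 * second_differential f (a + \<tau> (a, b) (u, v) * (u - a), b + \<tau> (a, b) (u, v) * (v - b)) (u - a) (v - b)"
  proof -
    have "\<forall>c. \<exists>\<tau> :: real \<times> real \<Rightarrow> real. \<tau> \<in> borel_measurable borel \<and> (\<forall>p. 0 < \<tau> p \<and> \<tau> p < 1) \<and>
      (\<forall>u v. f (u, v) = f c + partial_x f c * (u - fst c) + partial_y f c * (v - snd c) +
        1 / fact 2 * second_differential f (fst c + \<tau> (u, v) * (u - fst c), snd c + \<tau> (u, v) * (v - snd c))
          (u - fst c) (v - snd c))"
      by (intro allI measurable_Taylor_parameter[OF assms(2)])
    from choice[OF this] obtain \<tau> where "\<forall>c. \<tau> c \<in> borel_measurable borel \<and> (\<forall>p. 0 < \<tau> c p \<and> \<tau> c p < 1) \<and>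
      (\<forall>u v. f (u, v) = f c + partial_x f c * (u - fst c) + partial_y f c * (v - snd c) +
        1 / fact 2 * second_differential f (fst c + \<tau> c (u, v) * (u - fst c), snd c + \<tau> c (u, v) * (v - snd c))
          (u - fst c) (v - snd c))"
      by blast
    then show thesis by (intro that[of \<tau>]) auto
  qed
  define \<theta>1 :: "real \<Rightarrow> int \<Rightarrow> int \<Rightarrow> real \<times> real \<Rightarrow> real" where
    "\<theta>1 w k j p = of_int k / w + \<tau> (of_int k / w, of_int j / w) p * (fst p - of_int k / w)" for w k j p
  define \<theta>2 :: "real \<Rightarrow> int \<Rightarrow> int \<Rightarrow> real \<times> real \<Rightarrow> real" where
    "\<theta>2 w k j p = of_int j / w + \<tau> (of_int k / w, of_int j / w) p * (snd p - of_int j / w)" for w k j p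
  have meas: "\<theta>1 w k j \<in> borel_measurable (restrict_space borel (cell w k j))"
    "\<theta>2 w k j \<in> borel_measurable (restrict_space borel (cell w k j))" for w k j
  proof -
    note [measurable] = \<tau>(1)
    have [measurable]: "fst \<in> borel \<rightarrow>\<^sub>M (borel :: real measure)" "snd \<in> borel \<rightarrow>\<^sub>M (borel :: real measure)"
      by (auto intro!: borel_measurable_continuous_onI continuous_intros)
    have "\<theta>1 w k j \<in> borel_measurable borel" "\<theta>2 w k j \<in> borel_measurable borel"
      unfolding \<theta>1_def [abs_def] \<theta>2_def [abs_def] by measurable
    then show "\<theta>1 w k j \<in> borel_measurable (restrict_space borel (cell w k j))"
      "\<theta>2 w k j \<in> borel_measurable (restrict_space borel (cell w k j))"
      by (simp_all add: measurable_restrict_space1)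
  qed
  have taylor: "(\<theta>1 w k j (u, v), \<theta>2 w k j (u, v)) \<in> cell w k j"
    "taylor_point f (of_int k / w) (of_int j / w) u v (\<theta>1 w k j (u, v), \<theta>2 w k j (u, v))"
    if "(u, v) \<in> cell w k j" for w k j u v
    unfolding taylor_point_def \<theta>1_def \<theta>2_def fst_conv snd_conv
    by (intro conjI cell_point_between[OF that] \<tau>)+
  have series: "abs_convergent (S_term \<kappa> w f x y) \<and>
       abs_convergent (G_term \<kappa> w f x y) \<and>
       abs_convergent (G_term \<kappa> w (partial_x f) x y) \<and>
       abs_convergent (G_term \<kappa> w (partial_y f) x y) \<and>
       abs_convergent (R_term \<kappa> w f \<theta>1 \<theta>2 x y) \<and>
       S_op \<kappa> w f x y =
         G_op \<kappa> w f x y + 1 / (2 * w) * G_op \<kappa> w (partial_x f) x y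
         + 1 / (2 * w) * G_op \<kappa> w (partial_y f) x y
         + 1 / fact 2 * double_series (R_term \<kappa> w f \<theta>1 \<theta>2 x y)" if w: "0 < w" for w x y
  proof -
    let ?S = "S_term \<kappa> w f x y" and ?G = "G_term \<kappa> w f x y"
    let ?Gx = "G_term \<kappa> w (partial_x f) x y" and ?Gy = "G_term \<kappa> w (partial_y f) x y"
    have kernel: "abs_convergent (\<lambda>k j. \<kappa> (w * x - of_int k, w * y - of_int j))"
      unfolding abs_convergent_def by (rule sampling_kernel_abs_summable[OF assms(1)])
    have G: "abs_convergent (G_term \<kappa> w g x y)" if g: "g \<in> C_bounded r" for g r
    proof -
      obtain B where "\<And>p. \<bar>g p\<bar> \<le> B" using C_bounded_bound[OF g] by blast
      then show ?thesis
        unfolding G_term_def [abs_def] by (intro abs_convergent_bounded_factor[OF kernel])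
    qed
    have S: "abs_convergent ?S"
    proof -
      obtain B where "\<And>p. \<bar>f p\<bar> \<le> B" using C_bounded_bound[OF assms(2)] by blast
      then show ?thesis
        unfolding S_term_def [abs_def]
        by (intro abs_convergent_bounded_factor[OF kernel] abs_cell_mean_le[OF w cont])
    qed
    note conv = S G[OF assms(2)] G[OF C_bounded_partials(1)[OF f2]] G[OF C_bounded_partials(2)[OF f2]]
    \<comment> \<open>Solving the averaged Taylor formula for the remainder gives its convergence and its sum at once.\<close>
    have R: "R_term \<kappa> w f \<theta>1 \<theta>2 x y =
      (\<lambda>k j. 2 * ?S k j + (- 2 * ?G k j + (- 1 / w * ?Gx k j + - 1 / w * ?Gy k j)))"
      by (intro ext) (simp add: R_term_def S_term_def G_term_def
        cell_mean_Taylor_remainder[OF w cont taylor(2)] algebra_simps)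
    note conv' = abs_convergent_add abs_convergent_cmult conv
    have "abs_convergent (R_term \<kappa> w f \<theta>1 \<theta>2 x y)"
      unfolding R by (intro conv')
    moreover have "double_series (R_term \<kappa> w f \<theta>1 \<theta>2 x y) =
      2 * double_series ?S + (- 2 * double_series ?G
        + (- 1 / w * double_series ?Gx + - 1 / w * double_series ?Gy))"
      unfolding R
      by (subst double_series_add double_series_cmult, (intro conv')+)+ (rule refl)
    then have "S_op \<kappa> w f x y =
         G_op \<kappa> w f x y + 1 / (2 * w) * G_op \<kappa> w (partial_x f) x y
         + 1 / (2 * w) * G_op \<kappa> w (partial_y f) x y
         + 1 / fact 2 * double_series (R_term \<kappa> w f \<theta>1 \<theta>2 x y)"
      using w by (simp add: S_op_def G_op_def field_simps)
    ultimately show ?thesis using conv by blast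
  qed
  show ?thesis
    by (rule exI[of _ \<theta>1], rule exI[of _ \<theta>2]) (use meas taylor series in \<open>auto simp: cell_def\<close>)
qed

end
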